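(* Let $N\ge 1$ and let $f:\{0,1\}^N\to\{0,1\}$ be a monotone Boolean function. Then $D(f)\le 256\, Q_2(f)^4$.
   Context: $f$ is monotone if its value either always weakly increases or always weakly decreases when more input bits are set to 1, i.e. $f$ is either non-decreasing or non-increasing with respect to the coordinatewise order on $\{0,1\}^N$. Deterministic decision trees: $D(f)$ is the minimum, over all deterministic classical algorithms (decision trees) that compute $f(X)$ for every $X\in\{0,1\}^N$ by adaptively querying individual bits $x_i$ of $X$, of the worst-case number of queries (the depth of the tree). Quantum networks: the input $X=(x_0,\ldots,x_{N-1})\in\{0,1\}^N$ is given as a black-box. A quantum network with $T$ queries acts on $m$ qubits (for some $m$) and is a sequence of unitary transformations $U_0,O,U_1,O,\ldots,U_{T-1},O,U_T$ applied in this order to the initial state $|0\rangle$, where the $U_j$ are arbitrary unitaries on $m$ qubits not depending on $X$, and the query $O$ (depending on $X$) maps each basis state $|i,b,z\rangle$ to $|i,b\oplus x_i,z\rangle$; here $i$ consists of $\lceil\log_2 N\rceil$ bits, $b$ is one bit, and $z$ consists of the remaining $m-\lceil\log_2 N\rceil-1$ bits (if $i\ge N$, the query leaves the basis state unchanged). The output is the value obtained by measuring the rightmost bit of the final state in the computational basis. The network computes $f$ with bounded error if for every $X\in\{0,1\}^N$ the output equals $f(X)$ with probability at least $2/3$. $Q_2(f)$ is the minimum $T$ such that some quantum network with $T$ queries computes $f$ with bounded error. *)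

theory Defs
  imports
    Complex_Main
    "HOL-Library.Log_Nat"
    "Jordan_Normal_Form.Schur_Decomposition"
begin

text \<open>
  A Boolean function on N bits is a function on Boolean lists of which only the values on
  lists of length N matter; all notions below quantify over such lists only.
\<close>

definition cube :: "nat \<Rightarrow> bool list set" where
  "cube N = {X. length X = N}"

definition monotone_boolean :: "nat \<Rightarrow> (bool list \<Rightarrow> bool) \<Rightarrow> bool" where
  "monotone_boolean N f \<longleftrightarrow>
     monotone_on (cube N) (list_all2 (\<le>)) (\<le>) f \<or>
     monotone_on (cube N) (list_all2 (\<le>)) (\<ge>) f"


datatype dtree = Answer bool | Query nat dtree dtree

primrec queries_below :: "nat \<Rightarrow> dtree \<Rightarrow> bool" where
  "queries_below N (Answer b) \<longleftrightarrow> True"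
| "queries_below N (Query i t0 t1) \<longleftrightarrow> i < N \<and> queries_below N t0 \<and> queries_below N t1"

primrec run_dtree :: "dtree \<Rightarrow> bool list \<Rightarrow> bool" where
  "run_dtree (Answer b) X = b"
| "run_dtree (Query i t0 t1) X = (if X ! i then run_dtree t1 X else run_dtree t0 X)"

primrec depth :: "dtree \<Rightarrow> nat" where
  "depth (Answer b) = 0"
| "depth (Query i t0 t1) = Suc (max (depth t0) (depth t1))"

definition dtree_computes :: "nat \<Rightarrow> dtree \<Rightarrow> (bool list \<Rightarrow> bool) \<Rightarrow> bool" where
  "dtree_computes N t f \<longleftrightarrow> queries_below N t \<and> (\<forall>X\<in>cube N. run_dtree t X = f X)"

definition deterministic_complexity :: "nat \<Rightarrow> (bool list \<Rightarrow> bool) \<Rightarrow> nat" where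
  "deterministic_complexity N f = (LEAST d. \<exists>t. dtree_computes N t f \<and> depth t = d)"


text \<open>
  States of m qubits are vectors of dimension \<open>2 ^ m\<close>. The index \<open>k < 2 ^ m\<close> stands for the
  basis state whose qubits, from left to right, are the binary digits of k, most significant
  first. Hence in \<open>|i,b,z\<rangle>\<close> the address i is given by the leading \<open>ceillog2 N\<close> digits of k,
  the target b is the digit of weight \<open>2 ^ (m - ceillog2 N - 1)\<close>, and the rightmost bit
  is set iff k is odd.
\<close>

definition query_index :: "nat \<Rightarrow> nat \<Rightarrow> bool list \<Rightarrow> nat \<Rightarrow> nat" where
  "query_index N m X k =
     (let i = drop_bit (m - ceillog2 N) k
      in if i < N \<and> X ! i then flip_bit (m - ceillog2 N - 1) k else k)"

definition query_matrix :: "nat \<Rightarrow> nat \<Rightarrow> bool list \<Rightarrow> complex mat" where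
  "query_matrix N m X = mat (2 ^ m) (2 ^ m) (\<lambda>(r, c). if r = query_index N m X c then 1 else 0)"

definition unitary_mat :: "nat \<Rightarrow> complex mat \<Rightarrow> bool" where
  "unitary_mat d U \<longleftrightarrow> U \<in> carrier_mat d d \<and> mat_adjoint U * U = 1\<^sub>m d \<and> U * mat_adjoint U = 1\<^sub>m d"

text \<open>
  A network with T queries on m qubits is given by unitaries \<open>U 0, \<dots>, U T\<close>; the values of U
  beyond T are irrelevant. There must be room for the address and the target bit.
\<close>

definition quantum_network :: "nat \<Rightarrow> nat \<Rightarrow> nat \<Rightarrow> (nat \<Rightarrow> complex mat) \<Rightarrow> bool" where
  "quantum_network N T m U \<longleftrightarrow> ceillog2 N + 1 \<le> m \<and> (\<forall>j\<le>T. unitary_mat (2 ^ m) (U j))"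

primrec network_state ::
  "nat \<Rightarrow> nat \<Rightarrow> (nat \<Rightarrow> complex mat) \<Rightarrow> bool list \<Rightarrow> nat \<Rightarrow> complex vec" where
  "network_state N m U X 0 = U 0 *\<^sub>v unit_vec (2 ^ m) 0"
| "network_state N m U X (Suc t) =
     U (Suc t) *\<^sub>v (query_matrix N m X *\<^sub>v network_state N m U X t)"

definition output_prob :: "nat \<Rightarrow> complex vec \<Rightarrow> bool \<Rightarrow> real" where
  "output_prob m \<psi> b = (\<Sum>k | k < 2 ^ m \<and> (odd k \<longleftrightarrow> b). (cmod (\<psi> $ k))\<^sup>2)"

definition computes_bounded_error ::
  "nat \<Rightarrow> nat \<Rightarrow> nat \<Rightarrow> (nat \<Rightarrow> complex mat) \<Rightarrow> (bool list \<Rightarrow> bool) \<Rightarrow> bool" where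
  "computes_bounded_error N T m U f \<longleftrightarrow>
     (\<forall>X\<in>cube N. output_prob m (network_state N m U X T) (f X) \<ge> 2 / 3)"

definition bounded_error_quantum_complexity :: "nat \<Rightarrow> (bool list \<Rightarrow> bool) \<Rightarrow> nat" where
  "bounded_error_quantum_complexity N f =
     (LEAST T. \<exists>m U. quantum_network N T m U \<and> computes_bounded_error N T m U f)"

end

theory Submission
  imports Defs
begin

text \<open>
  For a fixed input X, flip each sensitive bit independently with probability p. The amplitudes
  of a network with T queries are multilinear of degree at most T in the flips, so its acceptance
  probability averaged over the flips is a polynomial in p of degree at most 2T with values
  in [0,1] on [0,1]. Its derivative at p = 0 is the sum of the changes caused by the single
  flips, each at least 1/3 in absolute value and all of the same sign. Markov's inequality at an
  endpoint bounds this derivative by (2T)^2, so the sensitivity of f is at most 12 T^2. A monotone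
  function has certificates of size at most its sensitivity s, which yields a decision
  tree of depth s^2, that is, at most 144 T^4.
\<close>

subsection \<open>Decision trees from small certificates\<close>

text \<open>Correctness is required only on \<open>C\<close>, so that subtrees for the inputs still
  possible after some answers can be built separately. A bound instead of an exact depth lets such
  subtrees be joined.\<close>

definition decidable_within :: "nat \<Rightarrow> (bool list \<Rightarrow> bool) \<Rightarrow> bool list set \<Rightarrow> nat \<Rightarrow> bool" where
  "decidable_within N f C d \<longleftrightarrow>
     (\<exists>t. queries_below N t \<and> depth t \<le> d \<and> (\<forall>X\<in>C. run_dtree t X = f X))"

lemma decidable_within_const:
  assumes "\<And>X. X \<in> C \<Longrightarrow> f X = b"
  shows "decidable_within N f C d"
  unfolding decidable_within_def by (rule exI[of _ "Answer b"]) (use assms in auto)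

text \<open>The tree asks the indices of \<open>V\<close> one after the other and continues with a
  subtree for the observed answers. Indexing the last premise by an input \<open>Y\<close> covers
  just the answers that occur in \<open>C\<close>.\<close>

lemma decidable_within_query:
  assumes "finite V" "V \<subseteq> {..<N}"
    and "\<And>Y. Y \<in> C \<Longrightarrow> decidable_within N f {Z \<in> C. \<forall>i\<in>V. Z ! i = Y ! i} d"
  shows "decidable_within N f C (card V + d)"
  using assms
proof (induction V arbitrary: C rule: finite_induct)
  case empty
  show ?case
  proof (cases "C = {}")
    case True
    then show ?thesis by (auto intro: decidable_within_const)
  next
    case False
    then show ?thesis using empty.prems(2) by auto
  qed
next
  case (insert v V)
  have half: "decidable_within N f {Z \<in> C. Z ! v = b} (card V + d)" for b
  proof (rule insert.IH)
    fix Y assume "Y \<in> {Z \<in> C. Z ! v = b}"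
    then have Y: "Y \<in> C" "Y ! v = b" by auto
    have "{Z \<in> {Z \<in> C. Z ! v = b}. \<forall>i\<in>V. Z ! i = Y ! i}
        = {Z \<in> C. \<forall>i\<in>insert v V. Z ! i = Y ! i}"
      using Y by auto
    then show "decidable_within N f {Z \<in> {Z \<in> C. Z ! v = b}. \<forall>i\<in>V. Z ! i = Y ! i} d"
      using insert.prems(2)[OF Y(1)] by simp
  qed (use insert.prems in auto)
  obtain t0 where t0: "queries_below N t0" "depth t0 \<le> card V + d"
      "\<And>X. X \<in> C \<Longrightarrow> \<not> X ! v \<Longrightarrow> run_dtree t0 X = f X"
    using half[of False] unfolding decidable_within_def by auto
  obtain t1 where t1: "queries_below N t1" "depth t1 \<le> card V + d"
      "\<And>X. X \<in> C \<Longrightarrow> X ! v \<Longrightarrow> run_dtree t1 X = f X"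
    using half[of True] unfolding decidable_within_def by auto
  show ?case
    unfolding decidable_within_def
    by (rule exI[of _ "Query v t0 t1"]) (use insert t0 t1 in auto)
qed

definition certificate :: "nat \<Rightarrow> (bool list \<Rightarrow> bool) \<Rightarrow> bool list \<Rightarrow> nat set \<Rightarrow> bool" where
  "certificate N f X W \<longleftrightarrow>
     W \<subseteq> {..<N} \<and> (\<forall>Z\<in>cube N. (\<forall>i\<in>W. Z ! i = X ! i) \<longrightarrow> f Z = f X)"

text \<open>
  Within a subcube, a certificate of a 1-input and one of a 0-input share a free index, so
  querying the free indices of one 1-certificate shortens every 0-certificate.
\<close>

lemma decidable_within_if_small_certificates_exist:
  assumes "C = {Z \<in> cube N. \<forall>i\<in>A. Z ! i = X ! i}"
    and "\<And>Y. Y \<in> C \<Longrightarrow> \<exists>W. certificate N f Y W \<and> card (W - A) \<le> (if f Y then s else k)"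
  shows "decidable_within N f C (s * k)"
  using assms
proof (induction k arbitrary: A C X)
  case 0
  show ?case
  proof (cases "\<forall>Y\<in>C. f Y")
    case True
    then show ?thesis by (auto intro: decidable_within_const)
  next
    case False
    then obtain Y where Y: "Y \<in> C" "\<not> f Y" by auto
    then obtain W where W: "certificate N f Y W" "card (W - A) = 0" using 0(2) by force
    then have "finite W" by (auto simp: certificate_def finite_subset)
    \<comment> \<open>A 0-certificate without free index is already met by every point of
      \<open>C\<close>, so \<open>f\<close> is constant there.\<close>
    then have "W \<subseteq> A" using W(2) by auto
    have "f Z = False" if "Z \<in> C" for Z
      using that W(1) Y \<open>W \<subseteq> A\<close> unfolding certificate_def 0(1) by blast
    then show ?thesis by (rule decidable_within_const)
  qed
next
  case (Suc k)
  show ?case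
  proof (cases "\<forall>Y\<in>C. \<not> f Y")
    case True
    then show ?thesis by (auto intro: decidable_within_const)
  next
    case False
    then obtain Y where Y: "Y \<in> C" "f Y" by auto
    then obtain W where W: "certificate N f Y W" "card (W - A) \<le> s" using Suc.prems(2) by force
    have WN: "W \<subseteq> {..<N}" "finite W" using W(1) by (auto simp: certificate_def finite_subset)
    \<comment> \<open>After these at most \<open>s\<close> queries each 0-input has a certificate
      with at most \<open>k\<close> indices outside \<open>A \<union> W\<close>, so the total is at
      most \<open>s + s * k = s * Suc k\<close>.\<close>
    have "decidable_within N f C (card (W - A) + s * k)"
    proof (rule decidable_within_query)
      fix X' assume X': "X' \<in> C"
      let ?C = "{Z \<in> C. \<forall>i\<in>W - A. Z ! i = X' ! i}"
      show "decidable_within N f ?C (s * k)"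
      proof (rule Suc.IH)
        show "?C = {Z \<in> cube N. \<forall>i\<in>A \<union> W. Z ! i = X' ! i}"
          using X' unfolding Suc.prems(1) by auto
        fix Y' assume Y': "Y' \<in> ?C"
        then obtain V where V: "certificate N f Y' V" "card (V - A) \<le> (if f Y' then s else Suc k)"
          using Suc.prems(2) by blast
        have fV: "finite V" using V(1) by (auto simp: certificate_def finite_subset)
        show "\<exists>V. certificate N f Y' V \<and> card (V - (A \<union> W)) \<le> (if f Y' then s else k)"
        proof (cases "f Y'")
          case True
          have "card (V - (A \<union> W)) \<le> card (V - A)" using fV by (intro card_mono) auto
          then show ?thesis using True V by auto
        next
          case False
          have "V \<inter> W - A \<noteq> {}"
          proof
            assume disj: "V \<inter> W - A = {}"
            \<comment> \<open>\<open>Z\<close> agrees with \<open>Y\<close> on \<open>W\<close>. It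
              agrees with \<open>Y'\<close> on \<open>V\<close>, because \<open>V\<close> and
              \<open>W\<close> meet only inside \<open>A\<close>, where \<open>Y\<close> and
              \<open>Y'\<close> coincide. Both certificates would then apply to \<open>Z\<close>,
              with opposite values.\<close>
            define Z where "Z = map (\<lambda>i. if i \<in> W then Y ! i else Y' ! i) [0..<N]"
            have Zc: "Z \<in> cube N" by (simp add: Z_def cube_def)
            have "\<forall>i\<in>W. Z ! i = Y ! i" using WN by (auto simp: Z_def)
            then have "f Z" using W(1) Zc Y(2) by (auto simp: certificate_def)
            have YY': "Y ! i = Y' ! i" if "i \<in> A" for i
              using that Y(1) Y' unfolding Suc.prems(1) by auto
            have "Z ! i = Y' ! i" if "i \<in> V" for i
            proof -
              have "i < N" using that V(1) by (auto simp: certificate_def)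
              then show ?thesis using that disj YY' by (auto simp: Z_def)
            qed
            then have "\<not> f Z" using V(1) Zc False by (auto simp: certificate_def)
            with \<open>f Z\<close> show False by simp
          qed
          then have "card (V - (A \<union> W)) < card (V - A)"
            using fV by (intro psubset_card_mono) auto
          then show ?thesis using False V by auto
        qed
      qed
    qed (use WN in auto)
    then show ?thesis
      using W(2) unfolding decidable_within_def by fastforce
  qed
qed

section \<open>Sensitivity and certificates of monotone functions\<close>

definition sensitive_indices :: "nat \<Rightarrow> (bool list \<Rightarrow> bool) \<Rightarrow> bool list \<Rightarrow> nat set" where
  "sensitive_indices N f X = {i. i < N \<and> f (X[i := \<not> X ! i]) \<noteq> f X}"

text \<open>
  A minimal set of ones (or of zeros) of X that already forces the value of a monotone f is a
  certificate, and each of its indices is sensitive once the other bits are switched to the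
  opposite value.
\<close>

lemma monotone_certificate:
  assumes mono: "monotone_boolean N f"
    and sens: "\<And>X. X \<in> cube N \<Longrightarrow> card (sensitive_indices N f X) \<le> s"
    and X: "X \<in> cube N"
  shows "\<exists>W. certificate N f X W \<and> card W \<le> s"
proof -
  \<comment> \<open>\<open>e\<close> is the value that survives raising bits: \<open>True\<close>
    for non-decreasing \<open>f\<close>, \<open>False\<close> for non-increasing
    \<open>f\<close>.\<close>
  obtain e where e: "\<And>Y Z. Y \<in> cube N \<Longrightarrow> Z \<in> cube N \<Longrightarrow> list_all2 (\<le>) Y Z \<Longrightarrow> f Y = e \<Longrightarrow> f Z = e"
  proof (cases "monotone_on (cube N) (list_all2 (\<le>)) (\<le>) f")
    case True
    then show ?thesis by (intro that[of True]) (auto simp: monotone_on_def)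
  next
    case False
    then have "monotone_on (cube N) (list_all2 (\<le>)) (\<ge>) f"
      using mono by (auto simp: monotone_boolean_def)
    then show ?thesis by (intro that[of False]) (auto simp: monotone_on_def)
  qed
  \<comment> \<open>Switching bits to \<open>c\<close> preserves the value \<open>f X\<close>:
    raising preserves \<open>e\<close>, and by contraposition lowering preserves the other value.
    \<open>XW W\<close> below has \<open>c\<close> on \<open>W\<close> and the opposite bit
    elsewhere.\<close>
  define c where "c \<longleftrightarrow> f X = e"
  define XW where "XW W = map (\<lambda>i. (i \<in> W) = c) [0..<N]" for W
  have XW: "XW W \<in> cube N" "\<And>i. i < N \<Longrightarrow> XW W ! i = ((i \<in> W) = c)" for W
    by (auto simp: XW_def cube_def)
  let ?P = "\<lambda>W. W \<subseteq> {i. i < N \<and> X ! i = c} \<and> f (XW W) = f X"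
  have "XW {i. i < N \<and> X ! i = c} = X"
    using X by (intro nth_equalityI) (auto simp: XW_def cube_def)
  then have "?P {i. i < N \<and> X ! i = c}" by simp
  from ex_has_least_nat[of ?P, OF this, of card]
  obtain W where W: "?P W" and least: "\<And>V. ?P V \<Longrightarrow> card W \<le> card V" by blast
  have WN: "W \<subseteq> {..<N}" using W by auto
  then have fW: "finite W" by (rule finite_subset) simp
  have "f Z = f X" if Z: "Z \<in> cube N" and ZW: "\<forall>i\<in>W. Z ! i = X ! i" for Z
  proof (cases c)
    case True
    have "list_all2 (\<le>) (XW W) Z"
      unfolding list_all2_conv_all_nth using Z XW True ZW W by (auto simp: cube_def)
    then show ?thesis using e[OF XW(1) Z] W True by (auto simp: c_def)
  next
    case False
    have "list_all2 (\<le>) Z (XW W)"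
      unfolding list_all2_conv_all_nth using Z XW False ZW W by (auto simp: cube_def)
    then show ?thesis using e[OF Z XW(1)] W False by (auto simp: c_def)
  qed
  then have cert: "certificate N f X W" using WN by (auto simp: certificate_def)
  have "W \<subseteq> sensitive_indices N f (XW W)"
  proof
    fix i assume i: "i \<in> W"
    then have iN: "i < N" using WN by auto
    have "(XW W)[i := \<not> XW W ! i] = XW (W - {i})"
      using iN i by (intro nth_equalityI) (auto simp: XW_def nth_list_update)
    moreover have "f (XW (W - {i})) \<noteq> f X"
    proof
      assume "f (XW (W - {i})) = f X"
      then have "card W \<le> card (W - {i})" using W by (intro least) auto
      then show False using i fW by (metis card_Diff1_less not_less)
    qed
    ultimately show "i \<in> sensitive_indices N f (XW W)"
      using iN W by (auto simp: sensitive_indices_def)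
  qed
  then have "card W \<le> card (sensitive_indices N f (XW W))"
    by (intro card_mono) (auto simp: sensitive_indices_def)
  also have "\<dots> \<le> s" by (rule sens) (rule XW(1))
  finally show ?thesis using cert by auto
qed

text \<open>The whole cube is the subcube with no fixed index, and monotonicity bounds the
  certificates of both kinds by \<open>s\<close>.\<close>

lemma deterministic_complexity_le_sensitivity_squared:
  assumes "monotone_boolean N f"
    and "\<And>X. X \<in> cube N \<Longrightarrow> card (sensitive_indices N f X) \<le> s"
  shows "deterministic_complexity N f \<le> s * s"
proof -
  have "decidable_within N f (cube N) (s * s)"
    by (rule decidable_within_if_small_certificates_exist[where A = "{}"])
      (use monotone_certificate[OF assms] in auto)
  then obtain t where "dtree_computes N t f" "depth t \<le> s * s"
    by (auto simp: decidable_within_def dtree_computes_def)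
  moreover from this have "(LEAST d. \<exists>t. dtree_computes N t f \<and> depth t = d) \<le> depth t"
    by (intro Least_le) auto
  ultimately show ?thesis
    unfolding deterministic_complexity_def by linarith
qed

subsection \<open>Markov's inequality at an endpoint\<close>

fun chebyshev :: "nat \<Rightarrow> real poly" where
  "chebyshev 0 = 1"
| "chebyshev (Suc 0) = [:0, 1:]"
| "chebyshev (Suc (Suc n)) = [:0, 2:] * chebyshev (Suc n) - chebyshev n"

lemma degree_chebyshev: "degree (chebyshev n) \<le> n"
proof (induction n rule: chebyshev.induct)
  case (3 n)
  have "degree ([:0, 2:] * chebyshev (Suc n)) \<le> degree [:0, 2 :: real:] + degree (chebyshev (Suc n))"
    by (rule degree_mult_le)
  then show ?case using 3 by (auto intro!: degree_diff_le)
qed auto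

text \<open>The product formula for cosines is the three-term recurrence.\<close>

lemma poly_chebyshev_cos: "poly (chebyshev n) (cos t) = cos (real n * t)"
proof (induction n rule: chebyshev.induct)
  case (3 n)
  have "cos (real (Suc (Suc n)) * t) + cos (real n * t) = 2 * cos t * cos (real (Suc n) * t)"
    using cos_times_cos[of t "real (Suc n) * t"] cos_minus[of "real n * t"]
    by (simp add: algebra_simps)
  then show ?case using 3 by (simp add: algebra_simps)
qed auto

lemma poly_chebyshev_1: "poly (chebyshev n) 1 = 1"
  using poly_chebyshev_cos[of n 0] by simp

text \<open>Differentiating the recurrence at 1 gives
  \<open>2 + 2 * (n + 1)^2 - n^2 = (n + 2)^2\<close>.\<close>

lemma poly_pderiv_chebyshev_1: "poly (pderiv (chebyshev n)) 1 = (real n)\<^sup>2"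
proof (induction n rule: chebyshev.induct)
  case (3 n)
  then show ?case
    by (simp add: pderiv_mult pderiv_diff pderiv_pCons pderiv_smult poly_chebyshev_1
        power2_eq_square algebra_simps)
qed (auto simp: pderiv_pCons)

text \<open>
  If \<open>r'(1) > d\<^sup>2\<close>, then for some \<open>c > 1\<close> the polynomial \<open>c T\<^sub>d - r\<close> has a critical point at 1.
  But it alternates in sign at the \<open>d + 1\<close> extremal points of the Chebyshev polynomial, so it
  has \<open>d\<close> roots and hence \<open>d - 1\<close> further critical points, all below 1.
\<close>

lemma markov_endpoint:
  fixes r :: "real poly"
  assumes deg: "degree r \<le> d" and bd: "\<And>x. -1 \<le> x \<Longrightarrow> x \<le> 1 \<Longrightarrow> \<bar>poly r x\<bar> \<le> 1"
  shows "poly (pderiv r) 1 \<le> (real d)\<^sup>2"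
proof (cases "d = 0")
  case True
  then have "pderiv r = 0" using deg by (simp add: pderiv_eq_0_iff)
  then show ?thesis by simp
next
  case d: False
  show ?thesis
  proof (rule ccontr)
    assume "\<not> ?thesis"
    then have gt: "poly (pderiv r) 1 > (real d)\<^sup>2" by simp
    \<comment> \<open>This factor makes the derivatives of \<open>c T_d\<close> and \<open>r\<close>
      at 1 cancel.\<close>
    define c where "c = poly (pderiv r) 1 / (real d)\<^sup>2"
    have c1: "c > 1" using gt d by (simp add: c_def)
    define h where "h = smult c (chebyshev d) - r"
    have h'1: "poly (pderiv h) 1 = 0"
      using d by (simp add: h_def pderiv_diff pderiv_smult poly_pderiv_chebyshev_1 c_def)
    have degh: "degree h \<le> d"
      unfolding h_def using deg degree_chebyshev[of d]
      by (intro degree_diff_le) (auto intro: order_trans[OF degree_smult_le])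
    \<comment> \<open>The extremal points of the Chebyshev polynomial, descending from
      \<open>x 0 = 1\<close> to \<open>x d = -1\<close>.\<close>
    define x where "x k = cos (real k * pi / real d)" for k
    have x_less: "x (Suc k) < x k" if "k < d" for k
    proof -
      have "real (Suc k) \<le> real d" using that by simp
      then have "real (Suc k) * pi / real d \<le> pi" using d by (simp add: divide_le_eq)
      moreover have "real k * pi / real d < real (Suc k) * pi / real d"
        using d by (intro divide_strict_right_mono mult_strict_right_mono) auto
      ultimately show ?thesis unfolding x_def by (intro cos_monotone_0_pi) auto
    qed
    \<comment> \<open>At \<open>x k\<close> the scaled Chebyshev polynomial equals \<open>c\<close>
      up to the sign \<open>(-1) ^ k\<close>, and \<open>c > 1\<close> outweighs
      \<open>r\<close>.\<close>
    have sgn: "(-1) ^ k * poly h (x k) > 0" for k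
    proof -
      have "poly (chebyshev d) (x k) = (-1) ^ k"
        using d poly_chebyshev_cos[of d "real k * pi / real d"] by (simp add: x_def cos_npi)
      moreover have "\<bar>poly r (x k)\<bar> \<le> 1" by (rule bd) (auto simp: x_def)
      then have "\<bar>(-1) ^ k * poly r (x k)\<bar> < c" using c1 by (simp add: abs_mult)
      ultimately show ?thesis
        by (simp add: h_def algebra_simps power_mult_distrib[symmetric])
    qed
    have "\<exists>z. x (Suc k) < z \<and> z < x k \<and> poly h z = 0" if "k < d" for k
    proof -
      have "poly h (x (Suc k)) * poly h (x k) < 0"
        using sgn[of k] sgn[of "Suc k"]
        by (cases "even k") (auto simp: mult_less_0_iff)
      then show ?thesis using poly_IVT[OF x_less[OF that]] by blast
    qed
    then obtain z where z: "\<And>k. k < d \<Longrightarrow> x (Suc k) < z k \<and> z k < x k \<and> poly h (z k) = 0"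
      by metis
    have "\<exists>w. z (Suc k) < w \<and> w < z k \<and> poly (pderiv h) w = 0" if "Suc k < d" for k
    proof -
      have lt: "z (Suc k) < z k" using z[of k] z[of "Suc k"] that by auto
      show ?thesis
        using poly_MVT[OF lt, of h] z[of k] z[of "Suc k"] that lt by auto
    qed
    then obtain w where w: "\<And>k. Suc k < d \<Longrightarrow> z (Suc k) < w k \<and> w k < z k \<and> poly (pderiv h) (w k) = 0"
      by metis
    \<comment> \<open>If \<open>pderiv h\<close> were nonzero, these would be \<open>d\<close>
      distinct zeros of a polynomial of degree at most \<open>d - 1\<close>.\<close>
    let ?R = "insert 1 (w ` {..<d - 1})"
    have "pderiv h = 0"
    proof (rule ccontr)
      assume nz: "pderiv h \<noteq> 0"
      have dec: "w j < w i" if "i < j" "Suc j < d" for i j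
        using that
      proof (induction j rule: less_induct)
        case (less j)
        then obtain k where k: "j = Suc k" by (cases j) auto
        have "w j < z j" "z (Suc k) < w k" using less.prems w[of j] w[of k] k by auto
        then have "w j < w k" using k by auto
        moreover have "w k < w i" if "i \<noteq> k"
          using less.prems k that by (intro less.IH) auto
        ultimately show ?case using k by (cases "i = k") auto
      qed
      have lt1: "w i < 1" if "Suc i < d" for i
      proof -
        have "w i < z i" "z i < x i" using that w z by auto
        moreover have "x i \<le> 1" by (simp add: x_def)
        ultimately show ?thesis by linarith
      qed
      have "inj_on w {..<d - 1}"
      proof (rule linorder_inj_onI)
        fix i j assume "i < j" "i \<in> {..<d - 1}" "j \<in> {..<d - 1}"
        then have "i < j" "Suc j < d" by auto
        then show "w i \<noteq> w j" using dec by fastforce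
      qed auto
      then have "card (w ` {..<d - 1}) = d - 1" by (simp add: card_image)
      moreover have "1 \<notin> w ` {..<d - 1}" using lt1
        by (metis imageE less_diff_conv lessThan_iff order_less_irrefl Suc_eq_plus1)
      ultimately have "d = card ?R" using d by simp
      also have "\<dots> \<le> card {x. poly (pderiv h) x = 0}"
        using w h'1 by (intro card_mono poly_roots_finite nz) auto
      also have "\<dots> \<le> degree (pderiv h)" by (rule card_poly_roots_bound[OF nz])
      also have "\<dots> \<le> d - 1" using degh by (simp add: degree_pderiv)
      finally show False using d by simp
    qed
    then have "degree h = 0" by (simp add: pderiv_eq_0_iff)
    \<comment> \<open>A constant cannot be positive at \<open>x 0\<close> and negative at
      \<open>x 1\<close>.\<close>
    then obtain a where "h = [:a:]" by (meson degree_eq_zeroE)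
    then show False using sgn[of 0] sgn[of 1] by simp
  qed
qed

text \<open>The map \<open>x \<mapsto> (1 - x) / 2\<close> carries [-1,1] onto [0,1] and 1 to 0.
  Stretching the values by 2 cancels the factor 1/2 in the derivative, and applying the endpoint
  bound to \<open>r\<close> and \<open>- r\<close> gives the absolute value.\<close>

lemma markov_endpoint_unit_interval:
  fixes q :: "real poly"
  assumes deg: "degree q \<le> d" and bd: "\<And>p. 0 \<le> p \<Longrightarrow> p \<le> 1 \<Longrightarrow> 0 \<le> poly q p \<and> poly q p \<le> 1"
  shows "\<bar>poly (pderiv q) 0\<bar> \<le> (real d)\<^sup>2"
proof -
  define r where "r = smult 2 (pcompose q [:1/2, -1/2:]) - 1"
  have degr: "degree r \<le> d"
  proof -
    have "degree (pcompose q [:1/2, -1/2:]) \<le> d"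
      using degree_pcompose_le[of q "[:1/2, -1/2:]"] deg by simp
    then show ?thesis unfolding r_def
      by (intro degree_diff_le) (auto intro: order_trans[OF degree_smult_le])
  qed
  have r: "poly r x = 2 * poly q ((1 - x) / 2) - 1" for x
    by (simp add: r_def poly_pcompose field_simps)
  have bdr: "\<bar>poly r x\<bar> \<le> 1" if "-1 \<le> x" "x \<le> 1" for x
    using bd[of "(1 - x) / 2"] that by (simp add: r abs_le_iff)
  have r': "poly (pderiv r) 1 = - poly (pderiv q) 0"
    by (simp add: r_def pderiv_diff pderiv_smult pderiv_pcompose poly_pcompose pderiv_pCons)
  have "poly (pderiv r) 1 \<le> (real d)\<^sup>2"
    by (rule markov_endpoint[OF degr bdr])
  moreover have "poly (pderiv (- r)) 1 \<le> (real d)\<^sup>2"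
    by (rule markov_endpoint) (use degr bdr in auto)
  ultimately show ?thesis by (simp add: r' pderiv_minus abs_le_iff)
qed

subsection \<open>Set functions of bounded degree\<close>

text \<open>For finite \<open>B\<close> these are the multilinear polynomials of degree at most
  \<open>d\<close> in the indicators of \<open>i \<in> S\<close> for \<open>i \<in> B\<close>:
  \<open>of_bool (I \<subseteq> S)\<close> is the product of the indicators over \<open>I\<close>.
  The general coefficient ring serves complex amplitudes and real probabilities alike.\<close>

inductive set_poly :: "'a set \<Rightarrow> nat \<Rightarrow> ('a set \<Rightarrow> 'b :: comm_ring_1) \<Rightarrow> bool" for B d where
  monom: "I \<subseteq> B \<Longrightarrow> card I \<le> d \<Longrightarrow> set_poly B d (\<lambda>S. c * of_bool (I \<subseteq> S))"
| add: "set_poly B d F \<Longrightarrow> set_poly B d G \<Longrightarrow> set_poly B d (\<lambda>S. F S + G S)"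

lemma set_poly_const: "set_poly B d (\<lambda>_. c)"
  using set_poly.monom[of "{}" B d c] by simp

lemma set_poly_mem:
  assumes "i \<in> B"
  shows "set_poly B (Suc 0) (\<lambda>S. of_bool (i \<in> S))"
  using set_poly.monom[of "{i}" B "Suc 0" 1] assms by simp

lemma set_poly_sum:
  assumes "\<And>x. x \<in> A \<Longrightarrow> set_poly B d (F x)"
  shows "set_poly B d (\<lambda>S. \<Sum>x\<in>A. F x S)"
proof (cases "finite A")
  case True
  then show ?thesis using assms
    by (induction A) (auto intro: set_poly_const set_poly.add)
qed (simp add: set_poly_const)

text \<open>Indicators are idempotent, so the product of the monomials of \<open>I\<close> and
  \<open>J\<close> is the monomial of \<open>I \<union> J\<close>.\<close>

lemma set_poly_mult:
  assumes "finite B" "set_poly B d F" "set_poly B e G"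
  shows "set_poly B (d + e) (\<lambda>S. F S * G S)"
  using assms(2)
proof induction
  case (monom I c)
  show ?case using assms(3)
  proof induction
    case (monom J c')
    have "card (I \<union> J) \<le> d + e"
      using card_Un_le[of I J] \<open>card I \<le> d\<close> monom by linarith
    then have "set_poly B (d + e) (\<lambda>S. c * c' * of_bool (I \<union> J \<subseteq> S))"
      using \<open>I \<subseteq> B\<close> monom by (intro set_poly.monom) auto
    moreover have "(\<lambda>S. c * c' * of_bool (I \<union> J \<subseteq> S))
        = (\<lambda>S. c * of_bool (I \<subseteq> S) * (c' * of_bool (J \<subseteq> S)))"
      by (auto simp: fun_eq_iff)
    ultimately show ?case by simp
  next
    case (add F G)
    then show ?case using set_poly.add by (simp add: distrib_left)
  qed
next
  case (add F F')
  then show ?case using set_poly.add by (simp add: distrib_right)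
qed

lemma set_poly_cmult:
  assumes "set_poly B d F"
  shows "set_poly B d (\<lambda>S. c * F S)"
  using assms
proof induction
  case (monom I c')
  then show ?case using set_poly.monom[of I B d "c * c'"] by (simp add: mult.assoc)
next
  case (add F G)
  then show ?case using set_poly.add by (simp add: distrib_left)
qed

text \<open>The monomials are real, so only the coefficients change.\<close>

lemma set_poly_Re:
  assumes "set_poly B d F"
  shows "set_poly B d (\<lambda>S. Re (F S))"
  using assms
proof induction
  case (monom I c)
  then show ?case using set_poly.monom[of I B d "Re c"]
    by (simp add: of_bool_def if_distrib cong: if_cong)
next
  case (add F G)
  then show ?case using set_poly.add by simp
qed

lemma set_poly_Im:
  assumes "set_poly B d F"
  shows "set_poly B d (\<lambda>S. Im (F S))"
proof -
  have "set_poly B d (\<lambda>S. Re (- \<i> * F S))" by (intro set_poly_Re set_poly_cmult assms)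
  then show ?thesis by simp
qed

text \<open>Passing from amplitudes to probabilities doubles the degree, as seen from the squares of
  real and imaginary part.\<close>

lemma set_poly_cmod_squared:
  assumes "finite B" "set_poly B d F"
  shows "set_poly B (2 * d) (\<lambda>S. (cmod (F S))\<^sup>2)"
proof -
  have "set_poly B (d + d) (\<lambda>S. Re (F S) * Re (F S) + Im (F S) * Im (F S))"
    by (intro set_poly.add set_poly_mult set_poly_Re set_poly_Im assms)
  then show ?thesis by (simp add: cmod_power2 mult_2 flip: power2_eq_square)
qed

text \<open>For \<open>p\<close> in [0,1] this is the expectation of \<open>F S\<close> when each
  element of \<open>B\<close> enters \<open>S\<close> independently with probability
  \<open>p\<close>. The formula makes sense for all real \<open>p\<close>, so it can be compared
  with a polynomial.\<close>

definition bernoulli_mean :: "'a set \<Rightarrow> ('a set \<Rightarrow> real) \<Rightarrow> real \<Rightarrow> real" where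
  "bernoulli_mean B F p = (\<Sum>S\<in>Pow B. p ^ card S * (1 - p) ^ card (B - S) * F S)"

lemma bernoulli_mean_superset:
  assumes "finite B" "I \<subseteq> B"
  shows "bernoulli_mean B (\<lambda>S. of_bool (I \<subseteq> S)) p = p ^ card I"
proof -
  have fI: "finite I" using assms finite_subset by auto
  \<comment> \<open>The factors \<open>p + g i\<close> are \<open>p\<close> on \<open>I\<close> and
    1 off \<open>I\<close>. In the expanded product, the zeros of \<open>g\<close> remove every
    \<open>S\<close> that does not contain \<open>I\<close>.\<close>
  define g where "g i = (if i \<in> I then 0 else 1 - p)" for i
  have "p ^ card I = (\<Prod>i\<in>B. if i \<in> I then p else 1)"
    using assms by (simp add: prod.If_cases Int_absorb1)
  also have "\<dots> = (\<Prod>i\<in>B. p + g i)" by (intro prod.cong) (auto simp: g_def)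
  also have "\<dots> = (\<Sum>S\<in>Pow B. (\<Prod>i\<in>S. p) * (\<Prod>i\<in>B - S. g i))"
    by (rule prod_add[OF assms(1)])
  also have "\<dots> = (\<Sum>S\<in>Pow B. p ^ card S * (1 - p) ^ card (B - S) * of_bool (I \<subseteq> S))"
  proof (rule sum.cong)
    fix S assume S: "S \<in> Pow B"
    have "(\<Prod>i\<in>B - S. g i) = (1 - p) ^ card (B - S) * of_bool (I \<subseteq> S)"
    proof (cases "I \<subseteq> S")
      case True
      then have "(\<Prod>i\<in>B - S. g i) = (\<Prod>i\<in>B - S. 1 - p)"
        by (intro prod.cong) (auto simp: g_def)
      then show ?thesis using True by simp
    next
      case False
      then obtain i where "i \<in> I" "i \<notin> S" by auto
      then have "i \<in> B - S" "g i = 0" using assms by (auto simp: g_def)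
      then have "(\<Prod>i\<in>B - S. g i) = 0" using assms(1) by (intro prod_zero) auto
      then show ?thesis using False by simp
    qed
    then show "(\<Prod>i\<in>S. p) * (\<Prod>i\<in>B - S. g i)
        = p ^ card S * (1 - p) ^ card (B - S) * of_bool (I \<subseteq> S)" by simp
  qed simp
  finally show ?thesis by (simp add: bernoulli_mean_def)
qed

lemma bernoulli_mean_const:
  assumes "finite B"
  shows "bernoulli_mean B (\<lambda>_. 1) p = 1"
  using bernoulli_mean_superset[OF assms, of "{}"] by simp

lemma bernoulli_mean_add:
  "bernoulli_mean B (\<lambda>S. F S + G S) p = bernoulli_mean B F p + bernoulli_mean B G p"
  by (simp add: bernoulli_mean_def sum.distrib algebra_simps)

lemma bernoulli_mean_cmult:
  "bernoulli_mean B (\<lambda>S. c * F S) p = c * bernoulli_mean B F p"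
  by (simp add: bernoulli_mean_def sum_distrib_left algebra_simps)

lemma bernoulli_mean_mono:
  assumes "0 \<le> p" "p \<le> 1" "\<And>S. S \<subseteq> B \<Longrightarrow> F S \<le> G S"
  shows "bernoulli_mean B F p \<le> bernoulli_mean B G p"
  unfolding bernoulli_mean_def using assms by (intro sum_mono mult_left_mono) auto

text \<open>A monomial of \<open>I\<close> averages to \<open>p ^ card I\<close>, whose derivative
  at 0 is 1 for a singleton \<open>I\<close> and 0 otherwise. Likewise, adding one element to the
  empty set changes that monomial only if \<open>I\<close> is the added singleton.\<close>

lemma set_poly_bernoulli_mean:
  assumes "finite B" "set_poly B d F"
  shows "\<exists>q. degree q \<le> d \<and> (\<forall>p. bernoulli_mean B F p = poly q p) \<and>
             poly (pderiv q) 0 = (\<Sum>i\<in>B. F {i} - F {})"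
  using assms(2)
proof induction
  case (monom I c)
  have "poly (pderiv (Polynomial.monom c (card I))) 0
      = (\<Sum>i\<in>B. c * of_bool (I \<subseteq> {i}) - c * of_bool (I \<subseteq> {}))"
  proof -
    consider "I = {}" | i where "I = {i}" | "card I > 1"
      using monom(1) assms(1)
      by (metis One_nat_def card_0_eq card_1_singletonE finite_subset less_one linorder_neqE_nat)
    then show ?thesis
    proof cases
      case (2 i)
      then show ?thesis using assms(1) monom(1)
        by (simp add: pderiv_monom poly_monom of_bool_def if_distrib[of "(*) c"] sum.delta' cong: if_cong)
    next
      case 3
      then have "\<not> I \<subseteq> {i}" for i using card_mono[of "{i}" I] by auto
      moreover have "I \<noteq> {}" using 3 by auto
      ultimately show ?thesis using 3 by (simp add: pderiv_monom poly_monom)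
    qed (simp add: pderiv_monom)
  qed
  then show ?case
    using monom bernoulli_mean_superset[OF assms(1) monom(1)]
    by (intro exI[of _ "Polynomial.monom c (card I)"])
      (auto simp: bernoulli_mean_cmult poly_monom intro: order_trans[OF degree_monom_le])
next
  case (add F G)
  then obtain q q' where
    "degree q \<le> d" "\<And>p. bernoulli_mean B F p = poly q p"
    "poly (pderiv q) 0 = (\<Sum>i\<in>B. F {i} - F {})"
    "degree q' \<le> d" "\<And>p. bernoulli_mean B G p = poly q' p"
    "poly (pderiv q') 0 = (\<Sum>i\<in>B. G {i} - G {})" by blast
  then show ?case
    by (intro exI[of _ "q + q'"])
      (auto simp: bernoulli_mean_add pderiv_add degree_add_le sum.distrib sum_subtractf algebra_simps)
qed

text \<open>An average of values in [0,1] stays in [0,1], so the endpoint inequality applies to the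
  mean as a polynomial in \<open>p\<close>.\<close>

lemma set_poly_influence_bound:
  fixes F :: "'a set \<Rightarrow> real"
  assumes "finite B" "set_poly B d F" "\<And>S. S \<subseteq> B \<Longrightarrow> 0 \<le> F S \<and> F S \<le> 1"
  shows "\<bar>\<Sum>i\<in>B. F {i} - F {}\<bar> \<le> (real d)\<^sup>2"
proof -
  obtain q where q: "degree q \<le> d" "\<And>p. bernoulli_mean B F p = poly q p"
    "poly (pderiv q) 0 = (\<Sum>i\<in>B. F {i} - F {})"
    using set_poly_bernoulli_mean[OF assms(1,2)] by blast
  have "0 \<le> poly q p \<and> poly q p \<le> 1" if "0 \<le> p" "p \<le> 1" for p
    using bernoulli_mean_mono[OF that, of B "\<lambda>_. 0" F] bernoulli_mean_mono[OF that, of B F "\<lambda>_. 1"]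
      bernoulli_mean_const[OF assms(1), of p] assms(3)
    by (simp add: q(2)[symmetric] bernoulli_mean_def[of _ "\<lambda>_. 0"])
  then show ?thesis using markov_endpoint_unit_interval[OF q(1)] q(3) by simp
qed

subsection \<open>States of quantum networks\<close>

definition norm_sq :: "complex vec \<Rightarrow> real" where
  "norm_sq v = (\<Sum>k<dim_vec v. (cmod (v $ k))\<^sup>2)"

lemma of_real_norm_sq: "complex_of_real (norm_sq v) = v \<bullet>c v"
  by (simp add: norm_sq_def scalar_prod_def complex_norm_square atLeast0LessThan del: of_real_power)

lemma mat_adjoint_dim [simp]:
  "dim_row (mat_adjoint A) = dim_col A" "dim_col (mat_adjoint A) = dim_row A"
  by (simp_all add: mat_adjoint_def)

lemma mat_adjoint_index:
  assumes "i < dim_col A" "j < dim_row A"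
  shows "mat_adjoint A $$ (i, j) = conjugate (A $$ (j, i))"
  using assms by (simp add: mat_adjoint_def mat_of_rows_index)

lemma cscalar_prod_mult_mat_vec:
  fixes A :: "complex mat"
  assumes A: "A \<in> carrier_mat d d" and v: "v \<in> carrier_vec d" and w: "w \<in> carrier_vec d"
  shows "(A *\<^sub>v v) \<bullet>c w = v \<bullet>c (mat_adjoint A *\<^sub>v w)"
proof -
  have "(A *\<^sub>v v) \<bullet>c w = (\<Sum>i<d. \<Sum>j<d. A $$ (i, j) * v $ j * conjugate (w $ i))"
    using A v w by (simp add: scalar_prod_def atLeast0LessThan sum_distrib_right)
  also have "\<dots> = (\<Sum>j<d. \<Sum>i<d. A $$ (i, j) * v $ j * conjugate (w $ i))"
    by (rule sum.swap)
  also have "\<dots> = v \<bullet>c (mat_adjoint A *\<^sub>v w)"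
    using A v w by (simp add: scalar_prod_def atLeast0LessThan sum_distrib_left mat_adjoint_index
        mult.assoc mult.left_commute)
  finally show ?thesis .
qed

lemma unitary_mat_norm_sq:
  assumes "unitary_mat d A" "v \<in> carrier_vec d"
  shows "norm_sq (A *\<^sub>v v) = norm_sq v"
proof -
  have A: "A \<in> carrier_mat d d" and id: "mat_adjoint A * A = 1\<^sub>m d"
    using assms(1) by (auto simp: unitary_mat_def)
  have adj: "mat_adjoint A \<in> carrier_mat d d" using A by auto
  have "(A *\<^sub>v v) \<bullet>c (A *\<^sub>v v) = v \<bullet>c (mat_adjoint A *\<^sub>v (A *\<^sub>v v))"
    using A assms(2) by (intro cscalar_prod_mult_mat_vec) auto
  also have "mat_adjoint A *\<^sub>v (A *\<^sub>v v) = v"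
    using assoc_mult_mat_vec[OF adj A assms(2)] id assms(2) by simp
  finally have "complex_of_real (norm_sq (A *\<^sub>v v)) = complex_of_real (norm_sq v)"
    by (simp only: of_real_norm_sq)
  then show ?thesis by (simp only: of_real_eq_iff)
qed

lemma network_state_carrier:
  assumes "quantum_network N T m U" "t \<le> T"
  shows "network_state N m U X t \<in> carrier_vec (2 ^ m)"
  using assms(2)
proof (induction t)
  case 0
  then show ?case using assms(1) by (auto simp: quantum_network_def unitary_mat_def)
next
  case (Suc t)
  have "query_matrix N m X *\<^sub>v network_state N m U X t \<in> carrier_vec (2 ^ m)"
    using Suc by (intro mult_mat_vec_carrier[of _ _ "2 ^ m"]) (auto simp: query_matrix_def)
  then show ?case
    using Suc.prems assms(1)
    by (auto simp: quantum_network_def unitary_mat_def intro: mult_mat_vec_carrier)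
qed

section \<open>The query as a permutation of basis states\<close>

context
  fixes N m :: nat
  assumes room: "ceillog2 N + 1 \<le> m"
begin

text \<open>The target is the digit just below the address. The premise \<open>room\<close> keeps
  the truncated subtraction from placing it inside the address.\<close>

lemma drop_bit_flip_target:
  "drop_bit (m - ceillog2 N) (flip_bit (m - ceillog2 N - 1) k) = drop_bit (m - ceillog2 N) (k :: nat)"
  by (rule bit_eqI) (use room in \<open>auto simp: bit_simps\<close>)

text \<open>The first query keeps the address, so the second one makes the same choice and undoes
  the flip.\<close>

lemma query_index_involution: "query_index N m X (query_index N m X k) = k"
proof -
  have "flip_bit n (flip_bit n k) = k" for n
    by (rule bit_eqI) (auto simp: bit_simps)
  then show ?thesis 
    by (auto simp add: query_index_def Let_def drop_bit_flip_target simp del: One_nat_def diff_diff_left)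
qed

lemma flip_target_less:
  assumes "k < 2 ^ m"
  shows "flip_bit (m - ceillog2 N - 1) k < (2 :: nat) ^ m"
proof -
  have "\<not> m \<le> m - ceillog2 N - 1" using room by linarith
  then have "take_bit m (flip_bit (m - ceillog2 N - 1) k) = flip_bit (m - ceillog2 N - 1) (take_bit m k)"
    by (simp only: take_bit_flip_bit_eq if_False)
  also have "take_bit m k = k" using assms by (simp add: take_bit_nat_eq_self_iff)
  finally show ?thesis by (simp add: take_bit_nat_eq_self_iff)
qed

lemma query_index_less: "k < 2 ^ m \<Longrightarrow> query_index N m X k < 2 ^ m"
  by (simp add: query_index_def Let_def flip_target_less del: One_nat_def diff_diff_left)

text \<open>A permutation matrix reads coordinates through the inverse permutation, and an
  involution is its own inverse.\<close>

lemma query_matrix_mult_vec: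
  assumes "v \<in> carrier_vec (2 ^ m)" "k < 2 ^ m"
  shows "(query_matrix N m X *\<^sub>v v) $ k = v $ query_index N m X k"
proof -
  have "(query_matrix N m X *\<^sub>v v) $ k
      = (\<Sum>c<2 ^ m. (if k = query_index N m X c then 1 else 0) * v $ c)"
    using assms by (simp add: query_matrix_def scalar_prod_def atLeast0LessThan)
  also have "\<dots> = (\<Sum>c<2 ^ m. if c = query_index N m X k then v $ c else 0)"
    by (intro sum.cong) (auto simp: query_index_involution)
  also have "\<dots> = v $ query_index N m X k"
    using query_index_less[OF assms(2)] by simp
  finally show ?thesis .
qed

lemma query_matrix_norm_sq:
  assumes "v \<in> carrier_vec (2 ^ m)"
  shows "norm_sq (query_matrix N m X *\<^sub>v v) = norm_sq v"
proof -
  have "norm_sq (query_matrix N m X *\<^sub>v v) = (\<Sum>k<2 ^ m. (cmod (v $ query_index N m X k))\<^sup>2)"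
    unfolding norm_sq_def using query_matrix_mult_vec[OF assms]
    by (intro sum.cong) (auto simp: query_matrix_def)
  also have "\<dots> = (\<Sum>k<2 ^ m. (cmod (v $ k))\<^sup>2)"
    by (rule sum.reindex_bij_witness[of _ "query_index N m X" "query_index N m X"])
      (auto simp: query_index_involution query_index_less)
  finally show ?thesis using assms by (simp add: norm_sq_def)
qed

end

lemma network_state_norm_sq:
  assumes "quantum_network N T m U" "t \<le> T"
  shows "norm_sq (network_state N m U X t) = 1"
  using assms(2)
proof (induction t)
  case 0
  have "norm_sq (unit_vec (2 ^ m) 0) = (\<Sum>k<(2 :: nat) ^ m. if k = 0 then 1 else 0)"
    unfolding norm_sq_def by (intro sum.cong) auto
  then have "norm_sq (unit_vec (2 ^ m) 0) = 1" by simp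
  moreover have "unitary_mat (2 ^ m) (U 0)" using assms(1) by (simp add: quantum_network_def)
  ultimately show ?case by (simp add: unitary_mat_norm_sq)
next
  case (Suc t)
  let ?v = "network_state N m U X t"
  have v: "?v \<in> carrier_vec (2 ^ m)" using network_state_carrier[OF assms(1)] Suc.prems by simp
  have "query_matrix N m X *\<^sub>v ?v \<in> carrier_vec (2 ^ m)"
    by (rule mult_mat_vec_carrier[OF _ v]) (simp add: query_matrix_def)
  moreover have "unitary_mat (2 ^ m) (U (Suc t))" "ceillog2 N + 1 \<le> m"
    using assms(1) Suc.prems by (simp_all add: quantum_network_def)
  ultimately show ?case
    using Suc v by (simp add: unitary_mat_norm_sq query_matrix_norm_sq)
qed

lemma output_prob_nonneg: "0 \<le> output_prob m v b"
  by (simp add: output_prob_def sum_nonneg)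

lemma output_prob_complement:
  assumes "v \<in> carrier_vec (2 ^ m)"
  shows "output_prob m v b + output_prob m v (\<not> b) = norm_sq v"
proof -
  have "output_prob m v b + output_prob m v (\<not> b)
      = (\<Sum>k\<in>{k. k < 2 ^ m \<and> (odd k \<longleftrightarrow> b)} \<union> {k. k < 2 ^ m \<and> (odd k \<longleftrightarrow> \<not> b)}. (cmod (v $ k))\<^sup>2)"
    unfolding output_prob_def by (rule sum.union_disjoint[symmetric]) auto
  also have "{k. k < 2 ^ m \<and> (odd k \<longleftrightarrow> b)} \<union> {k. k < 2 ^ m \<and> (odd k \<longleftrightarrow> \<not> b)} = {..<2 ^ m}" by auto
  finally show ?thesis using assms by (simp add: norm_sq_def)
qed

subsection \<open>Sensitivity versus quantum queries\<close>

lemma set_poly_le: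
  assumes "set_poly B d F" "d \<le> e"
  shows "set_poly B e F"
  using assms(1)
proof induction
  case (monom I c)
  then show ?case using assms(2) by (intro set_poly.monom) auto
next
  case (add F G)
  then show ?case by (intro set_poly.add)
qed

text \<open>The choice equals the indicator times \<open>F - G\<close>, plus \<open>G\<close>; this
  accounts for the one degree gained per query.\<close>

lemma set_poly_if_mem:
  assumes "finite B" "i \<in> B" "set_poly B d F" "set_poly B d G"
  shows "set_poly B (Suc d) (\<lambda>S. if i \<in> S then F S else G S)"
proof -
  have "set_poly B (Suc 0 + d) (\<lambda>S. of_bool (i \<in> S) * (F S + -1 * G S) + G S)"
    using assms set_poly_le[OF assms(4), of "Suc 0 + d"]
    by (intro set_poly.add set_poly_mult set_poly_mem set_poly_cmult) auto
  moreover have "(\<lambda>S. of_bool (i \<in> S) * (F S + -1 * G S) + G S) = (\<lambda>S. if i \<in> S then F S else G S)"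
    by (auto simp: fun_eq_iff)
  ultimately show ?thesis by simp
qed

lemma set_poly_mult_mat_vec:
  assumes "A \<in> carrier_mat n n" "\<And>S. V S \<in> carrier_vec n"
    and "\<And>k. k < n \<Longrightarrow> set_poly B d (\<lambda>S. V S $ k)" "k < n"
  shows "set_poly B d (\<lambda>S. (A *\<^sub>v V S) $ k)"
proof -
  have "dim_vec (V S) = n" for S using assms(2)[of S] by simp
  then have "(\<lambda>S. (A *\<^sub>v V S) $ k) = (\<lambda>S. \<Sum>c\<in>{..<n}. A $$ (k, c) * V S $ c)"
    using assms(1,4) by (simp add: fun_eq_iff scalar_prod_def atLeast0LessThan)
  moreover have "set_poly B d (\<lambda>S. \<Sum>c\<in>{..<n}. A $$ (k, c) * V S $ c)"
    using assms(3) by (intro set_poly_sum set_poly_cmult) auto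
  ultimately show ?thesis by simp
qed

definition flip_bits :: "bool list \<Rightarrow> nat set \<Rightarrow> bool list" where
  "flip_bits X S = map (\<lambda>i. X ! i \<noteq> (i \<in> S)) [0..<length X]"

lemma flip_bits_in_cube [simp]: "flip_bits X S \<in> cube N \<longleftrightarrow> X \<in> cube N"
  by (simp add: flip_bits_def cube_def)

lemma flip_bits_empty: "flip_bits X {} = X"
  by (simp add: flip_bits_def map_nth)

lemma flip_bits_singleton: "i < length X \<Longrightarrow> flip_bits X {i} = X[i := \<not> X ! i]"
  by (intro nth_equalityI) (auto simp: flip_bits_def nth_list_update)

text \<open>A fixed basis index \<open>k\<close> has a fixed address \<open>i\<close>, so the new
  amplitude is an old one at \<open>k\<close> or \<open>k'\<close>, chosen by a single input bit.
  The choice depends on \<open>S\<close> only if \<open>i\<close> is an address in \<open>B\<close>;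
  intersecting with \<open>B\<close> ensures this for arbitrary \<open>S\<close>.\<close>

lemma set_poly_query_matrix:
  assumes room: "ceillog2 N + 1 \<le> m" and B: "finite B" and X: "X \<in> cube N"
    and V: "\<And>S. V S \<in> carrier_vec (2 ^ m)" "\<And>k. k < 2 ^ m \<Longrightarrow> set_poly B d (\<lambda>S. V S $ k)"
    and k: "k < 2 ^ m"
  shows "set_poly B (Suc d) (\<lambda>S. (query_matrix N m (flip_bits X (S \<inter> B)) *\<^sub>v V S) $ k)"
proof -
  define i where "i = drop_bit (m - ceillog2 N) k"
  define k' where "k' = flip_bit (m - ceillog2 N - 1) k"
  have k': "k' < 2 ^ m" unfolding k'_def by (rule flip_target_less[OF room k])
  have "set_poly B (Suc d) (\<lambda>S. V S $ query_index N m (flip_bits X (S \<inter> B)) k)"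
  proof (cases "i < N \<and> i \<in> B")
    case True
    have "set_poly B (Suc d) (\<lambda>S. if i \<in> S then V S $ (if X ! i then k else k')
                                            else V S $ (if X ! i then k' else k))"
      using True k k' by (intro set_poly_if_mem B V(2)) auto
    moreover have "V S $ query_index N m (flip_bits X (S \<inter> B)) k
        = (if i \<in> S then V S $ (if X ! i then k else k') else V S $ (if X ! i then k' else k))" for S
      using X True by (simp add: query_index_def Let_def flip_bits_def cube_def i_def k'_def)
    ultimately show ?thesis by (simp only:)
  next
    case False
    have "query_index N m (flip_bits X (S \<inter> B)) k = (if i < N \<and> X ! i then k' else k)" for S
      using X False by (auto simp: query_index_def Let_def flip_bits_def cube_def i_def k'_def)
    moreover have "set_poly B (Suc d) (\<lambda>S. V S $ (if i < N \<and> X ! i then k' else k))"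
      using k k' by (intro set_poly_le[OF V(2), of _ "Suc d"]) auto
    ultimately show ?thesis by (simp only:)
  qed
  then show ?thesis by (simp only: query_matrix_mult_vec[OF room V(1) k])
qed

text \<open>The unitaries do not depend on the input and only form linear combinations, so the
  degree grows only at the queries.\<close>

lemma set_poly_amplitude:
  assumes net: "quantum_network N T m U" and B: "finite B" and X: "X \<in> cube N"
    and "t \<le> T" "k < 2 ^ m"
  shows "set_poly B t (\<lambda>S. network_state N m U (flip_bits X (S \<inter> B)) t $ k)"
  using assms(4,5)
proof (induction t arbitrary: k)
  case 0
  then show ?case by (simp add: set_poly_const)
next
  case (Suc t)
  let ?V = "\<lambda>S. network_state N m U (flip_bits X (S \<inter> B)) t"
  have V: "?V S \<in> carrier_vec (2 ^ m)" for S
    using network_state_carrier[OF net] Suc.prems by simp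
  have "set_poly B (Suc t)
      (\<lambda>S. (U (Suc t) *\<^sub>v (query_matrix N m (flip_bits X (S \<inter> B)) *\<^sub>v ?V S)) $ k)"
  proof (rule set_poly_mult_mat_vec)
    show "U (Suc t) \<in> carrier_mat (2 ^ m) (2 ^ m)"
      using net Suc.prems by (auto simp: quantum_network_def unitary_mat_def)
    show "query_matrix N m (flip_bits X (S \<inter> B)) *\<^sub>v ?V S \<in> carrier_vec (2 ^ m)" for S
      by (rule mult_mat_vec_carrier[OF _ V]) (simp add: query_matrix_def)
    show "set_poly B (Suc t) (\<lambda>S. (query_matrix N m (flip_bits X (S \<inter> B)) *\<^sub>v ?V S) $ j)"
      if "j < 2 ^ m" for j
      using net Suc that by (intro set_poly_query_matrix B X V) (auto simp: quantum_network_def)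
  qed (rule Suc.prems)
  then show ?case by simp
qed

text \<open>Each sensitive flip lowers the probability of the output \<open>f X\<close> by at least
  1/3. Degree \<open>2 * T\<close> bounds the total change by \<open>(2 * T)^2\<close>, and
  multiplying by 3 gives \<open>12 * T^2\<close>.\<close>

lemma sensitivity_le_queries_squared:
  assumes net: "quantum_network N T m U" and comp: "computes_bounded_error N T m U f"
    and X: "X \<in> cube N"
  shows "card (sensitive_indices N f X) \<le> 12 * T\<^sup>2"
proof -
  define B where "B = sensitive_indices N f X"
  have B: "finite B" "B \<subseteq> {..<N}" by (auto simp: B_def sensitive_indices_def)
  \<comment> \<open>Following the output \<open>f X\<close> instead of \<open>True\<close> makes all
    contributions decreases, so none cancel.\<close>
  define F where "F S = output_prob m (network_state N m U (flip_bits X (S \<inter> B)) T) (f X)" for S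
  have total: "output_prob m (network_state N m U Y T) b + output_prob m (network_state N m U Y T) (\<not> b) = 1"
    for Y b
    using output_prob_complement network_state_carrier[OF net order_refl]
      network_state_norm_sq[OF net order_refl] by simp
  have F01: "0 \<le> F S \<and> F S \<le> 1" for S
    unfolding F_def using total output_prob_nonneg by (metis le_add_same_cancel1)
  have "set_poly B (2 * T) F"
    unfolding F_def output_prob_def
    by (intro set_poly_sum set_poly_cmod_squared set_poly_amplitude[OF net] B X) auto
  then have bound: "\<bar>\<Sum>i\<in>B. F {i} - F {}\<bar> \<le> (real (2 * T))\<^sup>2"
    using F01 by (intro set_poly_influence_bound B) auto
  have F0: "F {} \<ge> 2 / 3"
    using comp X by (simp add: F_def flip_bits_empty computes_bounded_error_def)
  have F1: "F {i} \<le> 1 / 3" if "i \<in> B" for i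
  proof -
    let ?Y = "X[i := \<not> X ! i]"
    have i: "i < N" "f ?Y = (\<not> f X)" using that by (auto simp: B_def sensitive_indices_def)
    have "?Y \<in> cube N" using X by (simp add: cube_def)
    then have "output_prob m (network_state N m U ?Y T) (f ?Y) \<ge> 2 / 3"
      using comp unfolding computes_bounded_error_def by blast
    then have "output_prob m (network_state N m U ?Y T) (\<not> f X) \<ge> 2 / 3"
      by (simp only: i(2))
    moreover have "flip_bits X ({i} \<inter> B) = ?Y"
      using i(1) X that by (simp add: flip_bits_singleton cube_def)
    ultimately show ?thesis using total[of ?Y "f X"] by (simp add: F_def)
  qed
  have "real (card B) / 3 = (\<Sum>i\<in>B. 1 / 3)" by simp
  also have "\<dots> \<le> (\<Sum>i\<in>B. F {} - F {i})" using F0 F1 by (intro sum_mono) force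
  also have "\<dots> \<le> \<bar>\<Sum>i\<in>B. F {i} - F {}\<bar>" by (simp add: sum_subtractf)
  finally have "real (card B) \<le> real (12 * T\<^sup>2)" using bound by (simp add: power2_eq_square)
  then show ?thesis unfolding B_def by (simp only: of_nat_le_iff)
qed

subsection \<open>Every Boolean function has a quantum network\<close>

text \<open>\<open>K\<close> and \<open>K'\<close> identify the same points, so sending
  \<open>K x\<close> to \<open>K' x\<close> is well defined and injective. In the finite set
  \<open>D\<close> the complements of both images have equal size, which leaves room for a bijection
  between them.\<close>

lemma extend_to_permutation:
  assumes "K ` C \<subseteq> D" "K' ` C \<subseteq> D" "finite D"
    and eq: "\<And>x y. x \<in> C \<Longrightarrow> y \<in> C \<Longrightarrow> K x = K y \<longleftrightarrow> K' x = K' y"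
  shows "\<exists>\<pi>. bij_betw \<pi> D D \<and> (\<forall>x\<in>C. \<pi> (K x) = K' x)"
proof -
  define g where "g = (\<lambda>k. K' (inv_into C K k))"
  have g: "g (K x) = K' x" if "x \<in> C" for x
    unfolding g_def using that eq[OF inv_into_into[of "K x" K C] that] f_inv_into_f[of "K x" K C]
    by auto
  have "inj_on g (K ` C)" using g eq by (auto simp: inj_on_def)
  moreover have "g ` K ` C = K' ` C" using g by (auto simp: image_iff)
  ultimately have bg: "bij_betw g (K ` C) (K' ` C)" by (simp add: bij_betw_def)
  have "card (D - K ` C) = card (D - K' ` C)"
    using assms bij_betw_same_card[OF bg] by (simp add: card_Diff_subset finite_subset)
  then obtain h where bh: "bij_betw h (D - K ` C) (D - K' ` C)"
    using finite_same_card_bij[of "D - K ` C" "D - K' ` C"] assms(3) by auto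
  define \<pi> where "\<pi> k = (if k \<in> K ` C then g k else h k)" for k
  have "bij_betw \<pi> (K ` C \<union> (D - K ` C)) (K' ` C \<union> (D - K' ` C))"
  proof (rule bij_betw_combine)
    show "bij_betw \<pi> (K ` C) (K' ` C)"
      using bg by (rule iffD1[OF bij_betw_cong, rotated]) (simp add: \<pi>_def)
    show "bij_betw \<pi> (D - K ` C) (D - K' ` C)"
      using bh by (rule iffD1[OF bij_betw_cong, rotated]) (simp add: \<pi>_def)
  qed auto
  moreover have "K ` C \<union> (D - K ` C) = D" "K' ` C \<union> (D - K' ` C) = D" using assms by auto
  ultimately show ?thesis using g by (intro exI[of _ \<pi>]) (auto simp: \<pi>_def)
qed

section \<open>Permutation matrices and reversible computation\<close>

definition permutation_mat :: "nat \<Rightarrow> (nat \<Rightarrow> nat) \<Rightarrow> complex mat" where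
  "permutation_mat d \<pi> = mat d d (\<lambda>(r, c). if r = \<pi> c then 1 else 0)"

lemma query_matrix_eq_permutation_mat:
  "query_matrix N m X = permutation_mat (2 ^ m) (query_index N m X)"
  by (simp add: query_matrix_def permutation_mat_def)

lemma permutation_mat_unit_vec:
  assumes "k < d"
  shows "permutation_mat d \<pi> *\<^sub>v unit_vec d k = unit_vec d (\<pi> k)"
proof (rule eq_vecI)
  fix i assume "i < dim_vec (unit_vec d (\<pi> k))"
  then have i: "i < d" by simp
  have "(permutation_mat d \<pi> *\<^sub>v unit_vec d k) $ i
      = (\<Sum>c<d. (if i = \<pi> c then 1 else 0) * unit_vec d k $ c)"
    using i by (simp add: permutation_mat_def scalar_prod_def atLeast0LessThan)
  also have "\<dots> = (\<Sum>c<d. if c = k then if i = \<pi> k then 1 else 0 else 0)"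
    by (intro sum.cong) (auto simp: unit_vec_def)
  also have "\<dots> = unit_vec d (\<pi> k) $ i" using assms i by (simp add: unit_vec_def)
  finally show "(permutation_mat d \<pi> *\<^sub>v unit_vec d k) $ i = unit_vec d (\<pi> k) $ i" .
qed (simp add: permutation_mat_def)

lemma unitary_permutation_mat:
  assumes "bij_betw \<pi> {..<d} {..<d}"
  shows "unitary_mat d (permutation_mat d \<pi>)"
proof -
  let ?P = "permutation_mat d \<pi>"
  have inj: "\<pi> i = \<pi> j \<longleftrightarrow> i = j" if "i < d" "j < d" for i j
    using assms that by (auto simp: bij_betw_def inj_on_def)
  have range: "\<pi> i < d" if "i < d" for i using assms that by (auto simp: bij_betw_def)
  have P: "?P $$ (i, j) = (if i = \<pi> j then 1 else 0)" if "i < d" "j < d" for i j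
    using that by (simp add: permutation_mat_def)
  have dim [simp]: "dim_row ?P = d" "dim_col ?P = d" by (simp_all add: permutation_mat_def)
  have adj: "mat_adjoint ?P $$ (i, j) = (if j = \<pi> i then 1 else 0)" if "i < d" "j < d" for i j
    using that P[OF that(2,1)] by (simp add: mat_adjoint_index)
  have "mat_adjoint ?P * ?P = 1\<^sub>m d"
  proof (rule eq_matI)
    fix i j assume ij: "i < dim_row (1\<^sub>m d)" "j < dim_col (1\<^sub>m d)"
    then have "(mat_adjoint ?P * ?P) $$ (i, j)
        = (\<Sum>l<d. mat_adjoint ?P $$ (i, l) * ?P $$ (l, j))"
      by (simp add: scalar_prod_def atLeast0LessThan)
    also have "\<dots> = (\<Sum>l<d. if l = \<pi> i then if \<pi> i = \<pi> j then 1 else 0 else 0)"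
      using ij by (intro sum.cong) (auto simp: P adj)
    also have "\<dots> = 1\<^sub>m d $$ (i, j)" using ij range inj by simp
    finally show "(mat_adjoint ?P * ?P) $$ (i, j) = 1\<^sub>m d $$ (i, j)" .
  qed simp_all
  moreover have "?P * mat_adjoint ?P = 1\<^sub>m d"
  proof (rule eq_matI)
    fix i j assume ij: "i < dim_row (1\<^sub>m d)" "j < dim_col (1\<^sub>m d)"
    then obtain i' where i': "i' < d" "i = \<pi> i'"
      using assms by (auto simp: bij_betw_def image_iff set_eq_iff)
    have "(?P * mat_adjoint ?P) $$ (i, j) = (\<Sum>l<d. ?P $$ (i, l) * mat_adjoint ?P $$ (l, j))"
      using ij by (simp add: scalar_prod_def atLeast0LessThan)
    also have "\<dots> = (\<Sum>l<d. if l = i' then if j = \<pi> i' then 1 else 0 else 0)"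
      using ij i' inj by (intro sum.cong) (auto simp: P adj)
    also have "\<dots> = 1\<^sub>m d $$ (i, j)" using ij i' by auto
    finally show "(?P * mat_adjoint ?P) $$ (i, j) = 1\<^sub>m d $$ (i, j)" .
  qed simp_all
  ultimately show ?thesis by (auto simp: unitary_mat_def permutation_mat_def)
qed

text \<open>By \<open>step\<close>, two inputs share an index just after a query iff they share the
  next index. Hence one permutation, independent of the input, performs the transition for all
  inputs at once.\<close>

lemma network_of_basis_states:
  fixes K :: "nat \<Rightarrow> bool list \<Rightarrow> nat"
  assumes room: "ceillog2 N + 1 \<le> m"
    and less: "\<And>t X. X \<in> cube N \<Longrightarrow> t \<le> T \<Longrightarrow> K t X < 2 ^ m"
    and K0: "\<And>X. X \<in> cube N \<Longrightarrow> K 0 X = 0"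
    and step: "\<And>t X Y. X \<in> cube N \<Longrightarrow> Y \<in> cube N \<Longrightarrow> t < T \<Longrightarrow>
      query_index N m X (K t X) = query_index N m Y (K t Y) \<longleftrightarrow> K (Suc t) X = K (Suc t) Y"
  shows "\<exists>U. quantum_network N T m U \<and>
    (\<forall>X\<in>cube N. \<forall>t\<le>T. network_state N m U X t = unit_vec (2 ^ m) (K t X))"
proof -
  have "\<exists>\<pi>. bij_betw \<pi> {..<2 ^ m} {..<2 ^ m} \<and>
      (\<forall>X\<in>cube N. \<pi> (query_index N m X (K t X)) = K (Suc t) X)" if "t < T" for t
    using that less step query_index_less[OF room]
    by (intro extend_to_permutation) auto
  then obtain \<pi> where bij: "\<And>t. t < T \<Longrightarrow> bij_betw (\<pi> t) {..<2 ^ m} {..<2 ^ m}"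
    and \<pi>: "\<And>t X. t < T \<Longrightarrow> X \<in> cube N \<Longrightarrow> \<pi> t (query_index N m X (K t X)) = K (Suc t) X"
    by metis
  \<comment> \<open>\<open>U 0\<close> is the identity since the start index is already
    \<open>K 0 X = 0\<close>; \<open>U (Suc t)\<close> follows the query made at time
    \<open>t\<close>.\<close>
  define U where "U j = (case j of 0 \<Rightarrow> permutation_mat (2 ^ m) id | Suc t \<Rightarrow> permutation_mat (2 ^ m) (\<pi> t))" for j
  have "unitary_mat (2 ^ m) (U j)" if "j \<le> T" for j
    using that bij by (auto simp: U_def split: nat.split intro!: unitary_permutation_mat bij_betw_id)
  then have "quantum_network N T m U" using room by (simp add: quantum_network_def)
  moreover have "network_state N m U X t = unit_vec (2 ^ m) (K t X)" if X: "X \<in> cube N" and "t \<le> T" for X t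
    using that(2)
  proof (induction t)
    case 0
    then show ?case using K0[OF X] by (simp add: U_def permutation_mat_unit_vec)
  next
    case (Suc t)
    then have "K t X < 2 ^ m" using less[OF X] by simp
    moreover from this have "query_index N m X (K t X) < 2 ^ m" by (rule query_index_less[OF room])
    ultimately show ?case
      using Suc \<pi>[OF _ X]
      by (simp add: U_def query_matrix_eq_permutation_mat permutation_mat_unit_vec)
  qed
  ultimately show ?thesis by blast
qed

lemma output_prob_unit_vec:
  assumes "k < 2 ^ m"
  shows "output_prob m (unit_vec (2 ^ m) k) (odd k) = 1"
proof -
  have "output_prob m (unit_vec (2 ^ m) k) (odd k)
      = (\<Sum>j | j < 2 ^ m \<and> (odd j \<longleftrightarrow> odd k). if j = k then 1 else 0)"
    unfolding output_prob_def using assms by (intro sum.cong) auto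
  then show ?thesis using assms by simp
qed

definition bits_value :: "bool list \<Rightarrow> nat" where
  "bits_value xs = horner_sum of_bool 2 xs"

lemma bits_value_less: "bits_value xs < 2 ^ length xs"
  unfolding bits_value_def by (induction xs) auto

lemma bits_value_inject:
  assumes "length xs = length ys"
  shows "bits_value xs = bits_value ys \<longleftrightarrow> xs = ys"
proof
  assume "bits_value xs = bits_value ys"
  then have "bit (bits_value xs) i = bit (bits_value ys) i" for i by simp
  then show "xs = ys"
    using assms by (intro nth_equalityI) (auto simp: bits_value_def bit_horner_sum_bit_iff)
qed simp

lemma add_mult_eq_iff:
  fixes a b c d n :: nat
  assumes "b < n" "d < n"
  shows "a * n + b = c * n + d \<longleftrightarrow> a = c \<and> b = d"
proof
  assume eq: "a * n + b = c * n + d"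
  from arg_cong[OF eq, of "\<lambda>x. x div n"] arg_cong[OF eq, of "\<lambda>x. x mod n"]
  show "a = c \<and> b = d" using assms by simp
qed simp

text \<open>
  The network stores the first t bits of the input before the query at address t, and writes
  the value of f into the last bit after the last query.
\<close>

lemma ex_quantum_network:
  assumes "N \<ge> 1"
  shows "\<exists>m U. quantum_network N N m U \<and> computes_bounded_error N N m U f"
proof -
  define n where "n = ceillog2 N"
  \<comment> \<open>\<open>n\<close> address qubits, one target qubit of weight
    \<open>2 ^ N\<close>, and \<open>N\<close> qubits of storage.\<close>
  define m where "m = n + 1 + N"
  have Nn: "N \<le> 2 ^ n" unfolding n_def by (rule le_two_power_ceillog2)
  \<comment> \<open>Before the last query the digits are the address \<open>t\<close>, a target of 0
    and the stored bits. Afterwards the answer is the lowest bit, and the whole input is kept above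
    it so that the last transition stays injective.\<close>
  define K where "K t X = (if t < N then t * 2 ^ (N + 1) + bits_value (take t X)
                                    else bits_value X * 2 + of_bool (f X))" for t X
  have val: "bits_value (take t X) < 2 ^ N" if "X \<in> cube N" for t X
  proof -
    have "(2 :: nat) ^ length (take t X) \<le> 2 ^ N"
      using that by (intro power_increasing) (auto simp: cube_def)
    then show ?thesis using bits_value_less[of "take t X"] by linarith
  qed
  have query: "query_index N m X (K t X) = (2 * t + of_bool (X ! t)) * 2 ^ N + bits_value (take t X)"
    if X: "X \<in> cube N" and t: "t < N" for X t
  proof -
    have K: "K t X = (2 * t) * 2 ^ N + bits_value (take t X)" using t by (simp add: K_def)
    have "K t X div 2 ^ N = 2 * t" using val[OF X, of t] by (simp add: K)
    then have bit: "\<not> bit (K t X) N" by (simp add: bit_iff_odd)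
    have "drop_bit (N + 1) (K t X) = t"
      using t val[OF X, of t] by (simp add: K_def drop_bit_eq_div)
    then show ?thesis
      using t bit K
      by (simp add: query_index_def m_def n_def[symmetric] Let_def flip_bit_eq_if set_bit_eq algebra_simps)
  qed
  have "\<exists>U. quantum_network N N m U \<and>
    (\<forall>X\<in>cube N. \<forall>t\<le>N. network_state N m U X t = unit_vec (2 ^ m) (K t X))"
  proof (rule network_of_basis_states)
    show "ceillog2 N + 1 \<le> m" by (simp add: m_def n_def)
    show "K t X < 2 ^ m" if X: "X \<in> cube N" for t X
    proof (cases "t < N")
      case True
      have "K t X < (t + 1) * 2 ^ (N + 1)" using True val[OF X, of t] by (simp add: K_def)
      also have "\<dots> \<le> 2 ^ n * 2 ^ (N + 1)" using True Nn by (intro mult_right_mono) auto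
      also have "\<dots> = 2 ^ m" by (simp add: m_def power_add)
      finally show ?thesis .
    next
      case False
      have "K t X < 2 ^ (N + 1)"
        using False X bits_value_less[of X] by (auto simp: K_def cube_def)
      also have "\<dots> \<le> 2 ^ m" by (intro power_increasing) (auto simp: m_def)
      finally show ?thesis .
    qed
    show "K 0 X = 0" for X using assms by (simp add: K_def bits_value_def)
    fix t X Y assume X: "X \<in> cube N" and Y: "Y \<in> cube N" and t: "t < N"
    have len: "length X = N" "length Y = N" using X Y by (auto simp: cube_def)
    have "query_index N m X (K t X) = query_index N m Y (K t Y) \<longleftrightarrow>
        X ! t = Y ! t \<and> bits_value (take t X) = bits_value (take t Y)"
      using query[OF X t] query[OF Y t] val[OF X, of t] val[OF Y, of t]
      by (simp add: add_mult_eq_iff)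
    \<comment> \<open>Target and storage together now hold the first \<open>Suc t\<close> bits, the
      same information as \<open>K (Suc t)\<close>. For \<open>Suc t = N\<close> this is all of
      \<open>X\<close>, which determines \<open>f X\<close>.\<close>
    also have "\<dots> \<longleftrightarrow> take (Suc t) X = take (Suc t) Y"
      using len t by (auto simp: bits_value_inject take_Suc_conv_app_nth)
    also have "\<dots> \<longleftrightarrow> K (Suc t) X = K (Suc t) Y"
    proof (cases "Suc t < N")
      case True
      then show ?thesis using len by (simp add: K_def bits_value_inject)
    next
      case False
      then have "Suc t = N" using t by simp
      then show ?thesis
        using len by (auto simp: K_def bits_value_inject add_mult_eq_iff)
    qed
    finally show "query_index N m X (K t X) = query_index N m Y (K t Y) \<longleftrightarrow>
      K (Suc t) X = K (Suc t) Y" .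
  qed
  then obtain U where U: "quantum_network N N m U"
    and state: "\<And>X. X \<in> cube N \<Longrightarrow> network_state N m U X N = unit_vec (2 ^ m) (K N X)"
    by blast
  have "output_prob m (network_state N m U X N) (f X) = 1" if X: "X \<in> cube N" for X
  proof -
    have "K N X < 2 ^ (N + 1)" using X bits_value_less[of X] by (auto simp: K_def cube_def)
    also have "(2 :: nat) ^ (N + 1) \<le> 2 ^ m" by (intro power_increasing) (auto simp: m_def)
    finally have "K N X < 2 ^ m" .
    moreover have "odd (K N X) = f X" by (simp add: K_def)
    ultimately show ?thesis using output_prob_unit_vec[of "K N X" m] state[OF X] by simp
  qed
  then have "computes_bounded_error N N m U f" by (simp add: computes_bounded_error_def)
  with U show ?thesis by blast
qed

theorem mainTheorem2:
  fixes N :: nat and f :: "bool list \<Rightarrow> bool"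
  assumes "N \<ge> 1"
    and "monotone_boolean N f"
  shows "deterministic_complexity N f \<le> 256 * bounded_error_quantum_complexity N f ^ 4"
proof -
  let ?T = "bounded_error_quantum_complexity N f"
  \<comment> \<open>The minimum is attained because some number of queries, namely \<open>N\<close>,
    suffices.\<close>
  have "\<exists>m U. quantum_network N ?T m U \<and> computes_bounded_error N ?T m U f"
    unfolding bounded_error_quantum_complexity_def
    by (rule LeastI_ex) (use ex_quantum_network[OF assms(1)] in blast)
  then obtain m U where "quantum_network N ?T m U" "computes_bounded_error N ?T m U f" by blast
  then have "deterministic_complexity N f \<le> 12 * ?T\<^sup>2 * (12 * ?T\<^sup>2)"
    using assms(2)
    by (intro deterministic_complexity_le_sensitivity_squared sensitivity_le_queries_squared)
  also have "\<dots> \<le> 256 * ?T ^ 4" by (simp add: power2_eq_square power4_eq_xxxx)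
  finally show ?thesis .
qed

end
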